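(* Let $M$ and $X$ be discrete random variables with joint distribution $p(m)p(x\mid m)$, and let $Z=T(X)$ be a deterministic function of $X$. Suppose that (Sufficiency) $I(Z;M)=I(X;M)$, and (Minimality) $I(Z;X)\le I(\tilde Z;X)$ for every statistic $\tilde Z$ of $X$ satisfying $I(\tilde Z;M)=I(X;M)$. Then $Z$ is precisely the minimal sufficient statistic of $X$ for $M$.
   Context: $M$ is the message (target) and $X$ the observation (the watermarked image), both taking values in discrete alphabets. $I(\cdot\,;\cdot)$ denotes mutual information. A statistic of $X$ is a random variable of the form $S(X)$ with $S$ a deterministic function on the alphabet of $X$, so that $M\to X\to S(X)$ is a Markov chain. A statistic $S(X)$ is sufficient for $M$ if the conditional distribution of $X$ given $S(X)$ does not depend on $M$: $p(x\mid s,m)=p(x\mid s)$ for all $x,s,m$ (for which the conditional probabilities are defined). A sufficient statistic $T(X)$ is a minimal sufficient statistic if for every other sufficient statistic $S(X)$ there is a function $f$ such that $T(X)=f(S(X))$ almost surely. "The" minimal sufficient statistic is understood up to isomorphism, i.e. up to an invertible relabelling of its values.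
   Formalization: The formal theorem additionally assumes that I(X;M) and I(Z;X) are finite (automatic for finite alphabets); on infinite discrete alphabets the claim fails without these assumptions. *)

theory Defs
  imports "HOL-Probability.Probability"
begin

text \<open>
  A discrete random variable is a random variable on a probability space \<open>\<Omega>\<close> with values in
  \<open>count_space UNIV\<close> over a countable type; a statistic of \<open>X\<close> is a function on the alphabet of
  \<open>X\<close>. Statistics that are quantified over inside a formula take values in \<open>nat\<close>: every
  discrete alphabet embeds into \<open>nat\<close>, so this is no restriction (see
  \<open>minimal_sufficient_statisticD\<close> below).
\<close>

text \<open>
  Mutual information with values in the extended reals. The library's \<open>mutual_information\<close> is a
  Bochner integral and therefore returns 0 when the defining series diverges. For discrete
  variables the joint law is absolutely continuous with respect to the product of the marginals
  and the negative part of the entropy density is integrable, so that divergence always means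
  that the mutual information is infinite.
\<close>

definition discrete_mutual_information ::
  "real \<Rightarrow> 'a measure \<Rightarrow> ('a \<Rightarrow> 'u::countable) \<Rightarrow> ('a \<Rightarrow> 'v::countable) \<Rightarrow> ereal"
where
  "discrete_mutual_information b \<Omega> U V =
    (if integrable
          (distr \<Omega> (count_space UNIV \<Otimes>\<^sub>M count_space UNIV) (\<lambda>\<omega>. (U \<omega>, V \<omega>)))
          (entropy_density b
            (distr \<Omega> (count_space UNIV) U \<Otimes>\<^sub>M distr \<Omega> (count_space UNIV) V)
            (distr \<Omega> (count_space UNIV \<Otimes>\<^sub>M count_space UNIV) (\<lambda>\<omega>. (U \<omega>, V \<omega>))))
     then ereal (prob_space.mutual_information \<Omega> b (count_space UNIV) (count_space UNIV) U V)
     else \<infinity>)"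

text \<open>
  \<open>p(x | s, m) = p(x | s)\<close> whenever \<open>p(s, m) > 0\<close>; then also \<open>p(s) > 0\<close>, so both conditional
  probabilities are defined.
\<close>

definition sufficient_statistic ::
  "'a measure \<Rightarrow> ('a \<Rightarrow> 'm) \<Rightarrow> ('a \<Rightarrow> 'x) \<Rightarrow> ('x \<Rightarrow> 's) \<Rightarrow> bool"
where
  "sufficient_statistic \<Omega> M X S \<longleftrightarrow>
    (\<forall>x s m. \<P>(\<omega> in \<Omega>. S (X \<omega>) = s \<and> M \<omega> = m) > 0 \<longrightarrow>
       \<P>(\<omega> in \<Omega>. X \<omega> = x \<bar> S (X \<omega>) = s \<and> M \<omega> = m) = \<P>(\<omega> in \<Omega>. X \<omega> = x \<bar> S (X \<omega>) = s))"

definition minimal_sufficient_statistic ::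
  "'a measure \<Rightarrow> ('a \<Rightarrow> 'm) \<Rightarrow> ('a \<Rightarrow> 'x) \<Rightarrow> ('x \<Rightarrow> 't) \<Rightarrow> bool"
where
  "minimal_sufficient_statistic \<Omega> M X T \<longleftrightarrow>
    sufficient_statistic \<Omega> M X T \<and>
    (\<forall>S :: 'x \<Rightarrow> nat. sufficient_statistic \<Omega> M X S \<longrightarrow>
       (\<exists>f. AE \<omega> in \<Omega>. T (X \<omega>) = f (S (X \<omega>))))"

definition invertible_relabelling ::
  "'a measure \<Rightarrow> ('a \<Rightarrow> 'x) \<Rightarrow> ('x \<Rightarrow> 's) \<Rightarrow> ('x \<Rightarrow> 't) \<Rightarrow> bool"
where
  "invertible_relabelling \<Omega> X S T \<longleftrightarrow>
    (\<exists>f g. AE \<omega> in \<Omega>. T (X \<omega>) = f (S (X \<omega>)) \<and> S (X \<omega>) = g (T (X \<omega>)))"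

lemma sufficient_statistic_to_nat:
  fixes S :: "'x \<Rightarrow> 's::countable"
  assumes "sufficient_statistic \<Omega> M X S"
  shows "sufficient_statistic \<Omega> M X (to_nat \<circ> S)"
  unfolding sufficient_statistic_def
proof (intro allI impI)
  fix x n m
  assume pos: "\<P>(\<omega> in \<Omega>. (to_nat \<circ> S) (X \<omega>) = n \<and> M \<omega> = m) > 0"
  then have "{\<omega> \<in> space \<Omega>. (to_nat \<circ> S) (X \<omega>) = n \<and> M \<omega> = m} \<noteq> {}"
    by (metis less_irrefl measure_empty)
  then obtain s where n: "n = to_nat (s :: 's)"
    by auto
  show "\<P>(\<omega> in \<Omega>. X \<omega> = x \<bar> (to_nat \<circ> S) (X \<omega>) = n \<and> M \<omega> = m) =
        \<P>(\<omega> in \<Omega>. X \<omega> = x \<bar> (to_nat \<circ> S) (X \<omega>) = n)"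
    using assms pos unfolding sufficient_statistic_def n by simp
qed

lemma minimal_sufficient_statisticD:
  fixes S :: "'x \<Rightarrow> 's::countable"
  assumes "minimal_sufficient_statistic \<Omega> M X T" "sufficient_statistic \<Omega> M X S"
  shows "\<exists>f. AE \<omega> in \<Omega>. T (X \<omega>) = f (S (X \<omega>))"
proof -
  obtain f where "AE \<omega> in \<Omega>. T (X \<omega>) = f ((to_nat \<circ> S) (X \<omega>))"
    using assms sufficient_statistic_to_nat unfolding minimal_sufficient_statistic_def by blast
  then show ?thesis
    by (intro exI[of _ "f \<circ> to_nat"]) simp
qed

end

theory Submission
  imports Defs
begin

text \<open>
  For \<open>Z = g(U)\<close> the chain rule reads \<open>I(U;W) = I(Z;W) + K\<close>, where \<open>K \<ge> 0\<close> is the conditional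
  divergence of \<open>p(w | u)\<close> from \<open>p(w | g u)\<close>; so if \<open>I(U;W)\<close> is finite, \<open>I(Z;W) = I(U;W)\<close> means
  that \<open>p(w | u)\<close> depends on \<open>g u\<close> only. Applied to \<open>U = X\<close>, \<open>W = M\<close>, this says that preserving the
  information about \<open>M\<close> is the same as being sufficient. Let \<open>S\<^sub>0 x\<close> label the posterior
  \<open>p(\<cdot> | x)\<close>; it is sufficient and a function of every sufficient statistic, in particular
  \<open>S\<^sub>0 = g(T)\<close>. Minimality gives \<open>I(T;X) \<le> I(g(T);X)\<close>, hence equality, and the chain rule applied
  a second time, to \<open>U = T(X)\<close> and \<open>W = X\<close>, shows that \<open>p(x | t)\<close> depends on \<open>g t\<close> only. As the
  supports of \<open>p(\<cdot> | t)\<close> for different \<open>t\<close> are disjoint, \<open>g\<close> is injective up to null sets, so \<open>T\<close>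
  is a function of \<open>S\<^sub>0\<close>.
\<close>

section \<open>Termwise nonnegative divergence\<close>

text \<open>
  The correction \<open>- r + w\<close> sums to zero over two probability distributions and makes every term
  nonnegative, so that divergences become sums in \<open>[0, \<infinity>]\<close> without convergence conditions.
\<close>

definition div_term :: "real \<Rightarrow> real \<Rightarrow> real" where
  "div_term r w = r * ln (r / w) - r + w"

text \<open>This is \<open>ln t <= t - 1\<close> at \<open>t = w / r\<close>, multiplied by
  \<open>r\<close>. Absolute continuity \<open>w = 0 ==> r = 0\<close> excludes the junk value
  \<open>r / 0 = 0\<close>, at which the term would be \<open>- r\<close>.\<close>

lemma div_term_nonneg:
  assumes "0 \<le> r" "0 \<le> w" "w = 0 \<Longrightarrow> r = 0"
  shows "0 \<le> div_term r w"
proof (cases "r = 0")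
  case False
  with assms have pos: "0 < r" "0 < w" by (auto simp: less_le)
  have "r * ln (w / r) \<le> r * (w / r - 1)"
    using pos by (intro mult_left_mono ln_le_minus_one) auto
  then show ?thesis using pos by (simp add: div_term_def ln_div algebra_simps)
qed (use assms in \<open>simp add: div_term_def\<close>)

text \<open>The tangent bound \<open>ln t <= t - 1\<close> is tight only at
  \<open>t = 1\<close>.\<close>

lemma div_term_eq_0_iff:
  assumes "0 \<le> r" "0 \<le> w" "w = 0 \<Longrightarrow> r = 0"
  shows "div_term r w = 0 \<longleftrightarrow> r = w"
proof
  assume eq: "div_term r w = 0"
  show "r = w"
  proof (cases "r = 0")
    case False
    with assms have pos: "0 < r" "0 < w" by (auto simp: less_le)
    have "r * ln (w / r) = r * (w / r - 1)"
      using eq pos by (simp add: div_term_def ln_div algebra_simps)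
    then have "ln (w / r) = w / r - 1" using pos by simp
    then show ?thesis using ln_eq_minus_one[of "w / r"] pos by simp
  qed (use eq in \<open>simp add: div_term_def\<close>)
qed (cases "w = 0"; simp add: div_term_def)

text \<open>Here \<open>h\<close> may change sign, so additivity of the nonnegative integral does
  not apply directly. If \<open>g\<close> is integrable, the Bochner integral is additive; otherwise
  \<open>f\<close> is not integrable either and both sides are infinite.\<close>

lemma nn_integral_add_integrable:
  fixes f g h :: "'a \<Rightarrow> real"
  assumes [measurable]: "f \<in> borel_measurable N" "g \<in> borel_measurable N"
    and nonneg: "\<And>x. 0 \<le> f x" "\<And>x. 0 \<le> g x"
    and h: "integrable N h" "0 \<le> (\<integral>x. h x \<partial>N)"
    and eq: "\<And>x. f x = g x + h x"
  shows "(\<integral>\<^sup>+x. f x \<partial>N) = (\<integral>\<^sup>+x. g x \<partial>N) + ennreal (\<integral>x. h x \<partial>N)"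
proof (cases "integrable N g")
  case True
  with h have "integrable N (\<lambda>x. g x + h x)" by simp
  then have "integrable N f" by (simp flip: eq)
  with True show ?thesis
    using h nonneg by (simp add: nn_integral_eq_integral eq flip: ennreal_plus)
next
  case False
  have "\<not> integrable N f"
  proof
    assume "integrable N f"
    then have "integrable N (\<lambda>x. f x - h x)" using h by simp
    with False show False by (simp add: eq)
  qed
  moreover have "(\<integral>\<^sup>+x. u x \<partial>N) = \<infinity>"
    if "\<not> integrable N u" "\<And>x. 0 \<le> u x" "u \<in> borel_measurable N" for u :: "'a \<Rightarrow> real"
    using that by (auto simp: integrable_iff_bounded simp flip: less_top)
  ultimately show ?thesis using False nonneg assms(1,2) by simp
qed

section \<open>Mutual information as a sum over a joint pmf\<close>

text \<open>Mutual information in nats, with infinity as a genuine value; the base of the logarithm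
  re-enters as the factor \<open>1 / ln b\<close>.\<close>

definition pmf_information :: "('u \<times> 'v) pmf \<Rightarrow> ennreal" where
  "pmf_information R =
    (\<integral>\<^sup>+y. div_term (pmf R y) (pmf (map_pmf fst R) (fst y) * pmf (map_pmf snd R) (snd y)) \<partial>count_space UNIV)"

lemma pmf_map_eq_0D: "pmf (map_pmf f R) (f y) = 0 \<Longrightarrow> pmf R y = 0"
  by (metis image_eqI pmf_eq_0_set_pmf set_map_pmf)

lemma marginals_eq_0D:
  "pmf (map_pmf fst R) (fst y) * pmf (map_pmf snd R) (snd y) = 0 \<Longrightarrow> pmf R y = 0"
  using pmf_map_eq_0D[of fst R y] pmf_map_eq_0D[of snd R y] by auto

text \<open>Both variables are functions of one \<open>Y\<close>, so that all informations in the
  theorem are computed from a single joint law. The entropy density becomes a log ratio of point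
  masses, and the added correction integrates to \<open>- 1 + 1 = 0\<close>.\<close>

lemma discrete_mutual_information_pmf:
  fixes f :: "'y \<Rightarrow> 'u::countable" and h :: "'y \<Rightarrow> 'v::countable"
  assumes "prob_space \<Omega>" and b: "1 < b" and Y[measurable]: "Y \<in> measurable \<Omega> (count_space UNIV)"
    and Q: "distr \<Omega> (count_space UNIV) Y = measure_pmf Q"
  shows "discrete_mutual_information b \<Omega> (\<lambda>\<omega>. f (Y \<omega>)) (\<lambda>\<omega>. h (Y \<omega>)) =
    enn2ereal (ennreal (1 / ln b) * pmf_information (map_pmf (\<lambda>y. (f y, h y)) Q))"
proof -
  interpret prob_space \<Omega> by fact
  define R where "R = map_pmf (\<lambda>y. (f y, h y)) Q"
  define p where "p = map_pmf fst R"
  define q where "q = map_pmf snd R"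
  define w where "w = (\<lambda>y. pmf p (fst y) * pmf q (snd y))"
  have distr_map: "distr \<Omega> (count_space UNIV) (\<lambda>\<omega>. g (Y \<omega>)) = measure_pmf (map_pmf g Q)"
    for g :: "'y \<Rightarrow> 'k"
    by (simp add: map_pmf_rep_eq Q[symmetric] distr_distr comp_def)
  have cs: "count_space UNIV \<Otimes>\<^sub>M count_space UNIV = (count_space UNIV :: ('u \<times> 'v) measure)"
    by (simp add: pair_measure_countable)
  have dU: "distr \<Omega> (count_space UNIV) (\<lambda>\<omega>. f (Y \<omega>)) = measure_pmf p"
    and dV: "distr \<Omega> (count_space UNIV) (\<lambda>\<omega>. h (Y \<omega>)) = measure_pmf q"
    and dR: "distr \<Omega> (count_space UNIV) (\<lambda>\<omega>. (f (Y \<omega>), h (Y \<omega>))) = measure_pmf R"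
    using distr_map[of f] distr_map[of h] distr_map[of "\<lambda>y. (f y, h y)"]
    by (simp_all add: p_def q_def R_def pmf.map_comp comp_def)
  interpret P: pair_prob_space "measure_pmf p" "measure_pmf q" ..
  have sets_P[simp]: "sets (measure_pmf p \<Otimes>\<^sub>M measure_pmf q) = UNIV"
  proof -
    have "sets (measure_pmf p \<Otimes>\<^sub>M measure_pmf q) =
        sets ((count_space UNIV :: 'u measure) \<Otimes>\<^sub>M (count_space UNIV :: 'v measure))"
      by (intro sets_pair_measure_cong) simp_all
    then show ?thesis unfolding cs by simp
  qed
  have single: "emeasure (measure_pmf p \<Otimes>\<^sub>M measure_pmf q) {y} = ennreal (w y)" for y
  proof -
    have "emeasure (measure_pmf p \<Otimes>\<^sub>M measure_pmf q) ({fst y} \<times> {snd y}) = ennreal (w y)"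
      by (subst measure_pmf.emeasure_pair_measure_Times)
        (simp_all add: emeasure_pmf_single w_def ennreal_mult'')
    then show ?thesis by simp
  qed
  have w0: "w y = 0 \<Longrightarrow> pmf R y = 0" for y
    unfolding w_def p_def q_def by (rule marginals_eq_0D)
  have ac: "absolutely_continuous (measure_pmf p \<Otimes>\<^sub>M measure_pmf q) (measure_pmf R)"
    unfolding absolutely_continuous_def
  proof
    fix A assume A: "A \<in> null_sets (measure_pmf p \<Otimes>\<^sub>M measure_pmf q)"
    have "pmf R y = 0" if "y \<in> A" for y
    proof -
      have "emeasure (measure_pmf p \<Otimes>\<^sub>M measure_pmf q) {y} \<le> emeasure (measure_pmf p \<Otimes>\<^sub>M measure_pmf q) A"
        using that by (intro emeasure_mono) auto
      then have "w y \<le> 0" using A by (simp add: null_sets_def single ennreal_eq_0_iff)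
      moreover have "0 \<le> w y" by (simp add: w_def)
      ultimately show ?thesis by (intro w0 order.antisym)
    qed
    then have "AE y in measure_pmf R. y \<notin> A" by (auto simp: AE_measure_pmf_iff set_pmf_iff)
    then show "A \<in> null_sets (measure_pmf R)" by (simp add: AE_iff_null_sets)
  qed
  define e where "e = entropy_density b (measure_pmf p \<Otimes>\<^sub>M measure_pmf q) (measure_pmf R)"
  \<comment> \<open>On atoms with \<open>pmf R y > 0\<close> the Radon-Nikodym derivative is
    \<open>pmf R y / w y\<close>; the factor \<open>pmf R y\<close> hides its value
    elsewhere.\<close>
  have e: "pmf R y * e y = pmf R y * ln (pmf R y / w y) / ln b" for y
  proof (cases "pmf R y = 0")
    case False
    have "ennreal (pmf R y) = RN_deriv (measure_pmf p \<Otimes>\<^sub>M measure_pmf q) (measure_pmf R) y * ennreal (w y)"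
      using P.RN_deriv_singleton[OF ac, of y] by (simp add: single emeasure_pmf_single)
    then have "pmf R y = enn2real (RN_deriv (measure_pmf p \<Otimes>\<^sub>M measure_pmf q) (measure_pmf R) y) * w y"
      by (metis enn2real_ennreal enn2real_mult pmf_nonneg w_def zero_le_mult_iff)
    moreover have "w y \<noteq> 0" using w0 False by blast
    ultimately show ?thesis by (simp add: e_def entropy_density_def log_def)
  qed simp
  have R_int: "integrable (count_space UNIV) (pmf R)" "(\<integral>y. pmf R y \<partial>count_space UNIV) = 1"
    by (simp_all add: integrable_pmf integral_pmf)
  have w_nn: "(\<integral>\<^sup>+y. w y \<partial>count_space UNIV) = 1"
  proof -
    have "(\<integral>\<^sup>+y. w y \<partial>count_space UNIV) = (\<integral>\<^sup>+u. \<integral>\<^sup>+v. w (u, v) \<partial>count_space UNIV \<partial>count_space UNIV)"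
      by (rule nn_integral_fst_count_space[symmetric])
    also have "\<dots> = 1"
      by (simp add: w_def ennreal_mult nn_integral_cmult nn_integral_pmf measure_pmf.emeasure_eq_measure)
    finally show ?thesis .
  qed
  have w_int: "integrable (count_space UNIV) w" "(\<integral>y. w y \<partial>count_space UNIV) = 1"
    using w_nn by (auto simp: w_def integrable_iff_bounded integral_eq_nn_integral)
  define d where "d = (\<lambda>y. div_term (pmf R y) (w y))"
  have d: "d y = pmf R y * e y * ln b - pmf R y + w y" for y
    using b by (simp add: d_def div_term_def e)
  have Re: "pmf R y * e y = (d y + pmf R y - w y) / ln b" for y
    using b by (simp add: d)
  \<comment> \<open>Up to the factor \<open>ln b\<close>, \<open>d\<close> differs from the weighted
    density by two integrable functions of integral 1.\<close>
  have int_iff: "integrable (measure_pmf R) e \<longleftrightarrow> integrable (count_space UNIV) d"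
  proof -
    have "integrable (measure_pmf R) e \<longleftrightarrow> integrable (count_space UNIV) (\<lambda>y. pmf R y * e y)"
      by (subst measure_pmf_eq_density, subst integrable_real_density) auto
    also have "\<dots> \<longleftrightarrow> integrable (count_space UNIV) d"
    proof
      assume "integrable (count_space UNIV) (\<lambda>y. pmf R y * e y)"
      then show "integrable (count_space UNIV) d"
        unfolding d using R_int w_int by (intro Bochner_Integration.integrable_add Bochner_Integration.integrable_diff) auto
    next
      assume "integrable (count_space UNIV) d"
      then show "integrable (count_space UNIV) (\<lambda>y. pmf R y * e y)"
        unfolding Re using R_int w_int by auto
    qed
    finally show ?thesis .
  qed
  have d_nonneg: "0 \<le> d y" for y
    unfolding d_def by (intro div_term_nonneg w0) (auto simp: w_def)
  have info: "pmf_information R = (\<integral>\<^sup>+y. d y \<partial>count_space UNIV)"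
    by (simp add: pmf_information_def d_def w_def p_def q_def)
  have dmi: "discrete_mutual_information b \<Omega> (\<lambda>\<omega>. f (Y \<omega>)) (\<lambda>\<omega>. h (Y \<omega>)) =
    (if integrable (measure_pmf R) e then ereal (\<integral>y. e y \<partial>measure_pmf R) else \<infinity>)"
    by (simp add: discrete_mutual_information_def mutual_information_def KL_divergence_def
        cs dU dV dR e_def)
  show ?thesis
  proof (cases "integrable (count_space UNIV) d")
    case True
    have "(\<integral>y. e y \<partial>measure_pmf R) = (\<integral>y. pmf R y * e y \<partial>count_space UNIV)"
      by (subst measure_pmf_eq_density, subst integral_real_density) auto
    also have "\<dots> = (\<integral>y. d y \<partial>count_space UNIV) / ln b"
      unfolding Re using True R_int w_int by simp
    finally show ?thesis
      using True b d_nonneg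
      by (simp add: dmi int_iff info nn_integral_eq_integral flip: R_def ennreal_mult')
  next
    case False
    then have "pmf_information R = \<infinity>"
      unfolding info using d_nonneg by (auto simp: integrable_iff_bounded simp flip: less_top)
    with False b show ?thesis by (simp add: dmi int_iff ennreal_mult_top flip: R_def)
  qed
qed

section \<open>The chain rule and its equality case\<close>

text \<open>
  \<open>p(w | u) = p(w | g u)\<close>, multiplied out to avoid zero denominators: \<open>U \<rightarrow> g(U) \<rightarrow> W\<close> is Markov.
\<close>

definition factors_through :: "('u \<times> 'w) pmf \<Rightarrow> ('u \<Rightarrow> 's) \<Rightarrow> bool" where
  "factors_through R g \<longleftrightarrow> (\<forall>u w.
     pmf R (u, w) * pmf (map_pmf (g \<circ> fst) R) (g u) =
     pmf (map_pmf fst R) u * pmf (map_pmf (apfst g) R) (g u, w))"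

text \<open>The map \<open>k\<close> parametrises a fibre by another type: \<open>u\<close> indexes
  the pairs \<open>(u, w)\<close> for the joint law, and itself for the marginal. The indicators let
  both sums run over all \<open>u\<close>, so that they can be combined.\<close>

lemma pmf_map_fibre:
  fixes P :: "'y pmf"
  assumes "inj_on k A" "k ` A = f -` {z}"
  shows "integrable (count_space UNIV) (\<lambda>a. indicator A a * pmf P (k a))"
    and "(\<integral>a. indicator A a * pmf P (k a) \<partial>count_space UNIV) = pmf (map_pmf f P) z"
proof -
  have bij: "bij_betw k A (f -` {z})" using assms by (auto simp: bij_betw_def)
  have "integrable (count_space A) (\<lambda>a. pmf P (k a))"
    using integrable_bij_count_space[OF bij, of "pmf P"] integrable_pmf by blast
  then show "integrable (count_space UNIV) (\<lambda>a. indicator A a * pmf P (k a))"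
    using integrable_restrict_space[of A "count_space UNIV" "\<lambda>a. pmf P (k a)"]
    by (simp add: restrict_count_space)
  have "(\<integral>a. indicator A a * pmf P (k a) \<partial>count_space UNIV) = (\<integral>a. pmf P (k a) \<partial>count_space A)"
    using integral_restrict_space[of A "count_space UNIV" "\<lambda>a. pmf P (k a)"]
    by (simp add: restrict_count_space)
  also have "\<dots> = pmf (map_pmf f P) z"
    using integral_bij_count_space[OF bij, of "pmf P"] by (simp add: integral_pmf pmf_map)
  finally show "(\<integral>a. indicator A a * pmf P (k a) \<partial>count_space UNIV) = pmf (map_pmf f P) z" .
qed

text \<open>Changes the reference value from \<open>p(u) p(w)\<close> to
  \<open>p(u) p(w | g u)\<close>. The remainder is linear in \<open>r\<close> and \<open>p\<close>,
  hence easy to sum over a fibre of \<open>g\<close>, where \<open>c\<close> is constant.\<close>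

lemma div_term_add:
  assumes "0 < q" "0 \<le> p" "0 \<le> c" "0 \<le> r" "p * c = 0 \<Longrightarrow> r = 0"
  shows "div_term r (p * q) = div_term r (p * c) + (r * ln (c / q) + p * (q - c))"
proof (cases "r = 0")
  case False
  with assms have "0 < r" "0 < p" "0 < c" by (auto simp: less_le)
  then show ?thesis using assms(1) by (simp add: div_term_def ln_div ln_mult algebra_simps)
qed (simp add: div_term_def algebra_simps)

lemma nn_integral_count_space_fibres:
  fixes F :: "'u \<Rightarrow> real" and g :: "'u \<Rightarrow> 's"
  shows "(\<integral>\<^sup>+u. ennreal (F u) \<partial>count_space UNIV) =
    (\<integral>\<^sup>+s. \<integral>\<^sup>+u. ennreal (indicator (g -` {s}) u * F u) \<partial>count_space UNIV \<partial>count_space UNIV)"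
proof -
  have "(\<integral>\<^sup>+s. \<integral>\<^sup>+u. ennreal (indicator (g -` {s}) u * F u) \<partial>count_space UNIV \<partial>count_space UNIV) =
      (\<integral>\<^sup>+u. \<integral>\<^sup>+s. ennreal (indicator (g -` {s}) u * F u) \<partial>count_space UNIV \<partial>count_space UNIV)"
    using nn_integral_snd_count_space[of "\<lambda>(u, s). ennreal (indicator (g -` {s}) u * F u)"]
      nn_integral_fst_count_space[of "\<lambda>(u, s). ennreal (indicator (g -` {s}) u * F u)"] by simp
  also have "\<dots> = (\<integral>\<^sup>+u. \<integral>\<^sup>+s. ennreal (F u) * indicator {g u} s \<partial>count_space UNIV \<partial>count_space UNIV)"
    by (intro nn_integral_cong) (auto split: split_indicator)
  finally show ?thesis by (simp add: nn_integral_cmult_indicator)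
qed

text \<open>Fix \<open>w\<close> and a label \<open>s\<close>, and sum \<open>div_term_add\<close>
  over the fibre of \<open>s\<close> with \<open>c = p(w | s)\<close>: the remainders add up to the
  divergence term of the coarse law at \<open>(s, w)\<close>. Summing over \<open>s\<close> and
  \<open>w\<close> gives the rule in \<open>[0, \<infinity>]\<close>.\<close>

lemma pmf_information_chain:
  fixes R :: "('u \<times> 'w) pmf" and g :: "'u \<Rightarrow> 's"
  defines "p \<equiv> map_pmf fst R" and "pg \<equiv> map_pmf (g \<circ> fst) R" and "Rg \<equiv> map_pmf (apfst g) R"
  shows "pmf_information R = pmf_information Rg +
    (\<integral>\<^sup>+y. div_term (pmf R y) (pmf p (fst y) * (pmf Rg (apfst g y) / pmf pg (g (fst y)))) \<partial>count_space UNIV)"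
proof -
  define q where "q = map_pmf snd R"
  define c where "c = (\<lambda>s w. pmf Rg (s, w) / pmf pg s)"
  have marg: "map_pmf fst Rg = pg" "map_pmf snd Rg = q"
    by (simp_all add: Rg_def pg_def q_def pmf.map_comp comp_def)
  have zero: "pmf R (u, w) = 0" if "pmf p u * c (g u) w = 0 \<or> pmf q w = 0" for u w
    using that pmf_map_eq_0D[of fst R "(u, w)"] pmf_map_eq_0D[of snd R "(u, w)"]
      pmf_map_eq_0D[of "apfst g" R "(u, w)"] pmf_map_eq_0D[of "g \<circ> fst" R "(u, w)"]
    by (auto simp: p_def q_def c_def Rg_def pg_def)
  have zero_g: "pmf Rg (s, w) = 0" if "pmf pg s * pmf q w = 0" for s w
    using marginals_eq_0D[of Rg "(s, w)"] that by (simp add: marg)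
  have pc: "pmf pg s * c s w = pmf Rg (s, w)" for s w
    using zero_g[of s w] by (simp add: c_def)
  have c_nonneg: "0 \<le> c s w" for s w by (simp add: c_def)
  define f where "f = (\<lambda>w u. div_term (pmf R (u, w)) (pmf p u * pmf q w))"
  define k where "k = (\<lambda>w u. div_term (pmf R (u, w)) (pmf p u * c (g u) w))"
  have f_nonneg: "0 \<le> f w u" and k_nonneg: "0 \<le> k w u" for w u
    unfolding f_def k_def using zero[of u w] c_nonneg
    by (auto intro!: div_term_nonneg simp: p_def)
  have fibre: "(\<integral>\<^sup>+u. indicator (g -` {s}) u * f w u \<partial>count_space UNIV) =
    (\<integral>\<^sup>+u. indicator (g -` {s}) u * k w u \<partial>count_space UNIV) +
    ennreal (div_term (pmf Rg (s, w)) (pmf pg s * pmf q w))" for s w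
  proof (cases "pmf q w = 0")
    case True
    then show ?thesis using zero[of _ w] zero_g[of _ w]
      by (simp add: f_def k_def div_term_def c_def cong: nn_integral_cong)
  next
    case False
    then have q: "0 < pmf q w" by (simp add: less_le)
    let ?A = "g -` {s}"
    let ?r = "\<lambda>u. indicator ?A u * pmf R (u, w)" and ?p = "\<lambda>u. indicator ?A u * pmf p u"
    let ?h = "\<lambda>u. ?r u * ln (c s w / pmf q w) + ?p u * (pmf q w - c s w)"
    have fib: "(\<lambda>u. (u, w)) ` ?A = apfst g -` {(s, w)}" by auto
    note r = pmf_map_fibre[where P=R, OF _ fib, folded Rg_def]
    have "map_pmf g p = pg" by (simp add: p_def pg_def pmf.map_comp)
    then have p: "integrable (count_space UNIV) ?p" "(\<integral>u. ?p u \<partial>count_space UNIV) = pmf pg s"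
      using pmf_map_fibre[of id ?A g s p] by auto
    have h: "integrable (count_space UNIV) ?h"
      using r p by (simp add: inj_on_def)
    have "(\<integral>u. ?h u \<partial>count_space UNIV) =
        pmf Rg (s, w) * ln (c s w / pmf q w) + pmf pg s * (pmf q w - c s w)"
      using r p by (simp add: inj_on_def)
    \<comment> \<open>By \<open>pc\<close>, \<open>pg(s) (q - c)\<close> is
      \<open>pg(s) q - Rg(s, w)\<close>, exactly the correction inside
      \<open>div_term\<close>.\<close>
    also have "\<dots> = div_term (pmf Rg (s, w)) (pmf pg s * pmf q w)"
      using pc[of s w] by (simp add: c_def div_term_def algebra_simps)
    finally have ih: "(\<integral>u. ?h u \<partial>count_space UNIV) = div_term (pmf Rg (s, w)) (pmf pg s * pmf q w)" .
    have eq: "indicator ?A u * f w u = indicator ?A u * k w u + ?h u" for u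
      using div_term_add[OF q, of "pmf p u" "c (g u) w" "pmf R (u, w)"] zero[of u w] c_nonneg
      by (auto simp: f_def k_def split: split_indicator)
    \<comment> \<open>Single remainders may be negative; only their sum over the fibre is a
      divergence term.\<close>
    have "0 \<le> (\<integral>u. ?h u \<partial>count_space UNIV)"
      unfolding ih using zero_g by (intro div_term_nonneg) auto
    then have "(\<integral>\<^sup>+u. ennreal (indicator ?A u * f w u) \<partial>count_space UNIV) =
        (\<integral>\<^sup>+u. ennreal (indicator ?A u * k w u) \<partial>count_space UNIV) + ennreal (\<integral>u. ?h u \<partial>count_space UNIV)"
      by (intro nn_integral_add_integrable h eq) (simp_all add: f_nonneg k_nonneg)
    then show ?thesis
      by (simp add: ih ennreal_mult' ennreal_indicator)
  qed
  have "pmf_information R = (\<integral>\<^sup>+w. \<integral>\<^sup>+u. f w u \<partial>count_space UNIV \<partial>count_space UNIV)"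
    unfolding pmf_information_def
    by (subst nn_integral_snd_count_space[symmetric]) (simp add: f_def p_def q_def)
  also have "\<dots> = (\<integral>\<^sup>+w. \<integral>\<^sup>+s. \<integral>\<^sup>+u. indicator (g -` {s}) u * f w u \<partial>count_space UNIV
      \<partial>count_space UNIV \<partial>count_space UNIV)"
    by (intro nn_integral_cong nn_integral_count_space_fibres)
  also have "\<dots> = (\<integral>\<^sup>+w. (\<integral>\<^sup>+s. \<integral>\<^sup>+u. indicator (g -` {s}) u * k w u \<partial>count_space UNIV \<partial>count_space UNIV)
      + (\<integral>\<^sup>+s. div_term (pmf Rg (s, w)) (pmf pg s * pmf q w) \<partial>count_space UNIV) \<partial>count_space UNIV)"
    by (simp add: fibre nn_integral_add)
  also have "\<dots> = (\<integral>\<^sup>+w. \<integral>\<^sup>+u. k w u \<partial>count_space UNIV \<partial>count_space UNIV) + pmf_information Rg"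
    unfolding pmf_information_def marg
    by (subst nn_integral_snd_count_space[symmetric])
      (simp add: nn_integral_count_space_fibres[of _ g, symmetric] nn_integral_add)
  also have "(\<integral>\<^sup>+w. \<integral>\<^sup>+u. k w u \<partial>count_space UNIV \<partial>count_space UNIV) =
    (\<integral>\<^sup>+y. div_term (pmf R y) (pmf p (fst y) * (pmf Rg (apfst g y) / pmf pg (g (fst y)))) \<partial>count_space UNIV)"
    by (subst nn_integral_snd_count_space[symmetric]) (simp add: k_def c_def)
  finally show ?thesis by (subst add.commute)
qed

text \<open>Data processing inequality: the residual of the chain rule is nonnegative.\<close>

lemma pmf_information_map_le: "pmf_information (map_pmf (apfst g) R) \<le> pmf_information R"
  unfolding pmf_information_chain[of R g] by simp

text \<open>The residual \<open>K\<close> sums nonnegative terms, so it vanishes iff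
  \<open>p(u, w) = p(u) p(w | g u)\<close> everywhere. Finiteness allows cancelling the information
  to obtain \<open>K = 0\<close>.\<close>

lemma pmf_information_map_eq_iff:
  fixes R :: "('u \<times> 'w) pmf" and g :: "'u \<Rightarrow> 's"
  shows "factors_through R g \<Longrightarrow> pmf_information (map_pmf (apfst g) R) = pmf_information R"
    and "pmf_information (map_pmf (apfst g) R) = pmf_information R \<Longrightarrow> pmf_information R < \<infinity> \<Longrightarrow>
      factors_through R g"
proof -
  define v where "v = (\<lambda>u w. pmf (map_pmf fst R) u *
      (pmf (map_pmf (apfst g) R) (g u, w) / pmf (map_pmf (g \<circ> fst) R) (g u)))"
  define K where "K = (\<integral>\<^sup>+y. div_term (pmf R y) (v (fst y) (snd y)) \<partial>count_space UNIV)"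
  have zero: "v u w = 0 \<Longrightarrow> pmf R (u, w) = 0" for u w
    using pmf_map_eq_0D[of fst R "(u, w)"]
      pmf_map_eq_0D[of "apfst g" R "(u, w)"] pmf_map_eq_0D[of "g \<circ> fst" R "(u, w)"]
    by (auto simp: v_def)
  have v_nonneg: "0 \<le> v u w" for u w by (simp add: v_def)
  have chain: "pmf_information R = pmf_information (map_pmf (apfst g) R) + K"
    unfolding pmf_information_chain[of R g] K_def v_def by (simp add: apfst_def map_prod_def split_beta)
  have "ennreal (div_term (pmf R (u, w)) (v u w)) = 0 \<longleftrightarrow> pmf R (u, w) = v u w" for u w
  proof -
    have "0 \<le> div_term (pmf R (u, w)) (v u w)"
      using zero[of u w] v_nonneg by (intro div_term_nonneg) simp_all
    then have "ennreal (div_term (pmf R (u, w)) (v u w)) = 0 \<longleftrightarrow> div_term (pmf R (u, w)) (v u w) = 0"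
      using ennreal_eq_0_iff antisym by force
    also have "\<dots> \<longleftrightarrow> pmf R (u, w) = v u w"
      using zero[of u w] v_nonneg by (intro div_term_eq_0_iff) simp_all
    finally show ?thesis .
  qed
  then have "K = 0 \<longleftrightarrow> (\<forall>u w. pmf R (u, w) = v u w)"
    by (simp add: K_def nn_integral_0_iff_AE AE_count_space)
  also have "\<dots> \<longleftrightarrow> factors_through R g"
  proof -
    have "pmf R (u, w) = v u w \<longleftrightarrow> pmf R (u, w) * pmf (map_pmf (g \<circ> fst) R) (g u) =
      pmf (map_pmf fst R) u * pmf (map_pmf (apfst g) R) (g u, w)" for u w
    proof (cases "pmf (map_pmf (g \<circ> fst) R) (g u) = 0")
      case True
      then have "pmf R (u, w) = 0" "pmf (map_pmf fst R) u = 0"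
        using pmf_map_eq_0D[of "g \<circ> fst" R "(u, w)"] pmf_map_eq_0D[of g "map_pmf fst R" u]
        by (simp_all add: pmf.map_comp)
      then show ?thesis by (simp add: v_def)
    qed (simp add: v_def field_simps)
    then show ?thesis by (simp add: factors_through_def)
  qed
  finally have K: "K = 0 \<longleftrightarrow> factors_through R g" .
  show "factors_through R g \<Longrightarrow> pmf_information (map_pmf (apfst g) R) = pmf_information R"
    using chain K by simp
  assume "pmf_information (map_pmf (apfst g) R) = pmf_information R" "pmf_information R < \<infinity>"
  then have "K = 0" using chain
    by (metis add_0_right ennreal_add_left_cancel infinity_ennreal_def less_irrefl)
  then show "factors_through R g" using K by simp
qed

text \<open>Forward, both quotients equal \<open>p(w | g u)\<close>. Backward,
  \<open>p(w | g u)\<close> is an average of \<open>p(w | a)\<close> over the fibre, hence equals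
  their common value.\<close>

lemma factors_through_iff:
  "factors_through R g \<longleftrightarrow> (\<forall>u u' w. pmf (map_pmf fst R) u \<noteq> 0 \<and> pmf (map_pmf fst R) u' \<noteq> 0 \<and> g u = g u' \<longrightarrow>
     pmf R (u, w) / pmf (map_pmf fst R) u = pmf R (u', w) / pmf (map_pmf fst R) u')"
    (is "_ \<longleftrightarrow> ?cond")
proof
  assume fac: "factors_through R g"
  have "pmf R (u, w) / pmf (map_pmf fst R) u =
      pmf (map_pmf (apfst g) R) (g u, w) / pmf (map_pmf (g \<circ> fst) R) (g u)"
    if "pmf (map_pmf fst R) u \<noteq> 0" for u w
  proof -
    have "pmf (map_pmf (g \<circ> fst) R) (g u) \<noteq> 0"
      using that pmf_map_eq_0D[of g "map_pmf fst R" u] by (auto simp: pmf.map_comp)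
    with that fac show ?thesis
      by (simp add: factors_through_def field_simps)
  qed
  then show ?cond by metis
next
  assume cond: ?cond
  show "factors_through R g"
    unfolding factors_through_def
  proof (intro allI)
    fix u w
    let ?p = "map_pmf fst R"
    show "pmf R (u, w) * pmf (map_pmf (g \<circ> fst) R) (g u) =
        pmf ?p u * pmf (map_pmf (apfst g) R) (g u, w)"
    proof (cases "pmf ?p u = 0")
      case True
      then show ?thesis using pmf_map_eq_0D[of fst R "(u, w)"] by simp
    next
      case False
      let ?A = "g -` {g u}" and ?c = "pmf R (u, w) / pmf ?p u"
      have fib: "(\<lambda>a. (a, w)) ` ?A = apfst g -` {(g u, w)}" by auto
      have "pmf (map_pmf (apfst g) R) (g u, w) =
          (\<integral>a. indicator ?A a * pmf R (a, w) \<partial>count_space UNIV)"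
        by (rule pmf_map_fibre(2)[OF _ fib, symmetric]) (simp add: inj_on_def)
      \<comment> \<open>For null \<open>a\<close> both integrands vanish; for the others the common
        quotient \<open>?c\<close> applies.\<close>
      also have "\<dots> = (\<integral>a. ?c * (indicator ?A a * pmf ?p a) \<partial>count_space UNIV)"
      proof (rule Bochner_Integration.integral_cong)
        fix a
        show "indicator ?A a * pmf R (a, w) = ?c * (indicator ?A a * pmf ?p a)"
        proof (cases "pmf ?p a = 0")
          case True
          then show ?thesis using pmf_map_eq_0D[of fst R "(a, w)"] by simp
        next
          assume a: "pmf ?p a \<noteq> 0"
          then have "pmf R (a, w) = ?c * pmf ?p a" if "g a = g u"
            using cond False that by (metis nonzero_eq_divide_eq)
          then show ?thesis by (auto split: split_indicator)
        qed
      qed simp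
      also have "\<dots> = ?c * pmf (map_pmf g ?p) (g u)"
        using pmf_map_fibre(2)[of id ?A g "g u" ?p] by (simp del: times_divide_eq_left)
      finally show ?thesis using False by (simp add: pmf.map_comp)
    qed
  qed
qed

section \<open>From random variables to pmfs\<close>

lemma (in prob_space) ex_pmf_distr:
  fixes Y :: "'a \<Rightarrow> 'y::countable"
  assumes Y: "Y \<in> measurable M (count_space UNIV)"
  shows "\<exists>Q. distr M (count_space UNIV) Y = measure_pmf Q"
proof -
  interpret D: prob_space "distr M (count_space UNIV) Y"
    by (rule prob_space_distr) fact
  have "AE y in distr M (count_space UNIV) Y. measure (distr M (count_space UNIV) Y) {y} \<noteq> 0"
    by (subst D.AE_support_countable) (auto intro!: exI[of _ UNIV])
  then show ?thesis
    by (intro exI[of _ "Abs_pmf (distr M (count_space UNIV) Y)"])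
      (simp add: Abs_pmf_inverse D.prob_space_axioms)
qed

text \<open>Cross-multiplying \<open>p(x | s, m) = p(x | s)\<close> at \<open>s = S x\<close> gives
  \<open>p(x, m) p(s) = p(x) p(s, m)\<close>; for \<open>s\<close> other than \<open>S x\<close>
  both sides are 0. If \<open>p(s, m) = 0\<close>, the product form holds because
  \<open>p(x, m) = 0\<close>.\<close>

lemma sufficient_statistic_iff_factors_through:
  fixes X :: "'a \<Rightarrow> 'x::countable" and M :: "'a \<Rightarrow> 'm::countable"
  assumes Y[measurable]: "(\<lambda>\<omega>. (X \<omega>, M \<omega>)) \<in> measurable \<Omega> (count_space UNIV)"
    and Q: "distr \<Omega> (count_space UNIV) (\<lambda>\<omega>. (X \<omega>, M \<omega>)) = measure_pmf Q"
  shows "sufficient_statistic \<Omega> M X S \<longleftrightarrow> factors_through Q S"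
proof -
  have meas: "\<P>(\<omega> in \<Omega>. A (X \<omega>) (M \<omega>)) = measure (measure_pmf Q) {y. A (fst y) (snd y)}" for A
    by (subst Q[symmetric], subst measure_distr) (auto intro!: arg_cong2[where f=measure])
  have 1: "\<P>(\<omega> in \<Omega>. S (X \<omega>) = s \<and> M \<omega> = m) = pmf (map_pmf (apfst S) Q) (s, m)" for s m
    using meas[of "\<lambda>x m'. S x = s \<and> m' = m"]
    by (auto simp: pmf_map intro!: arg_cong2[where f=measure])
  have 2: "\<P>(\<omega> in \<Omega>. S (X \<omega>) = s) = pmf (map_pmf (S \<circ> fst) Q) s" for s
    using meas[of "\<lambda>x m'. S x = s"]
    by (auto simp: pmf_map vimage_def)
  have 3: "\<P>(\<omega> in \<Omega>. X \<omega> = x \<and> S (X \<omega>) = s \<and> M \<omega> = m) = (if S x = s then pmf Q (x, m) else 0)" for x s m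
  proof -
    have "{y. fst y = x \<and> S (fst y) = s \<and> snd y = m} = (if S x = s then {(x, m)} else {})" by auto
    then show ?thesis
      using meas[of "\<lambda>x' m'. x' = x \<and> S x' = s \<and> m' = m"] by (simp add: measure_pmf_single)
  qed
  have 4: "\<P>(\<omega> in \<Omega>. X \<omega> = x \<and> S (X \<omega>) = s) = (if S x = s then pmf (map_pmf fst Q) x else 0)" for x s
  proof -
    have "{y :: 'x \<times> 'm. fst y = x \<and> S (fst y) = s} = (if S x = s then fst -` {x} else {})" by auto
    then show ?thesis
      using meas[of "\<lambda>x' m'. x' = x \<and> S x' = s"] by (simp add: pmf_map)
  qed
  have "sufficient_statistic \<Omega> M X S \<longleftrightarrow> (\<forall>x m. pmf (map_pmf (apfst S) Q) (S x, m) \<noteq> 0 \<longrightarrow>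
      pmf Q (x, m) / pmf (map_pmf (apfst S) Q) (S x, m) =
      pmf (map_pmf fst Q) x / pmf (map_pmf (S \<circ> fst) Q) (S x))"
    unfolding sufficient_statistic_def cond_prob_def 1 2 3 4 by (auto simp: less_le)
  also have "\<dots> \<longleftrightarrow> factors_through Q S"
  proof -
    have "(pmf (map_pmf (apfst S) Q) (S x, m) \<noteq> 0 \<longrightarrow>
      pmf Q (x, m) / pmf (map_pmf (apfst S) Q) (S x, m) =
      pmf (map_pmf fst Q) x / pmf (map_pmf (S \<circ> fst) Q) (S x)) \<longleftrightarrow>
      pmf Q (x, m) * pmf (map_pmf (S \<circ> fst) Q) (S x) =
      pmf (map_pmf fst Q) x * pmf (map_pmf (apfst S) Q) (S x, m)" for x m
    proof (cases "pmf (map_pmf (apfst S) Q) (S x, m) = 0")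
      case True
      then show ?thesis using pmf_map_eq_0D[of "apfst S" Q "(x, m)"] by simp
    next
      case False
      then have "pmf (map_pmf (S \<circ> fst) Q) (S x) \<noteq> 0"
        using pmf_map_eq_0D[of fst "map_pmf (apfst S) Q" "(S x, m)"] by (auto simp: pmf.map_comp comp_def)
      with False show ?thesis by (simp add: field_simps)
    qed
    then show ?thesis by (simp add: factors_through_def)
  qed
  finally show ?thesis .
qed

section \<open>Minimality and uniqueness via the posterior statistic\<close>

theorem theorem3p3:
  fixes \<Omega> :: "'a measure" and b :: real
    and M :: "'a \<Rightarrow> 'm::countable" and X :: "'a \<Rightarrow> 'x::countable"
    and T :: "'x \<Rightarrow> 'z::countable"
  assumes "prob_space \<Omega>" and "1 < b"
    and "M \<in> measurable \<Omega> (count_space UNIV)"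
    and "X \<in> measurable \<Omega> (count_space UNIV)"
    and finite_info: "discrete_mutual_information b \<Omega> X M < \<infinity>"
      "discrete_mutual_information b \<Omega> (\<lambda>\<omega>. T (X \<omega>)) X < \<infinity>"
    and sufficiency:
      "discrete_mutual_information b \<Omega> (\<lambda>\<omega>. T (X \<omega>)) M = discrete_mutual_information b \<Omega> X M"
    and minimality:
      "\<And>S :: 'x \<Rightarrow> nat.
         discrete_mutual_information b \<Omega> (\<lambda>\<omega>. S (X \<omega>)) M = discrete_mutual_information b \<Omega> X M \<Longrightarrow>
         discrete_mutual_information b \<Omega> (\<lambda>\<omega>. T (X \<omega>)) X
           \<le> discrete_mutual_information b \<Omega> (\<lambda>\<omega>. S (X \<omega>)) X"
  shows "minimal_sufficient_statistic \<Omega> M X T \<and>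
    (\<forall>T' :: 'x \<Rightarrow> 'w::countable.
       minimal_sufficient_statistic \<Omega> M X T' \<longrightarrow> invertible_relabelling \<Omega> X T T')"
proof -
  interpret prob_space \<Omega> by fact
  have Y[measurable]: "(\<lambda>\<omega>. (X \<omega>, M \<omega>)) \<in> measurable \<Omega> (count_space UNIV)"
    using measurable_Pair[OF assms(4,3)] by (simp add: pair_measure_countable)
  obtain Q where Q: "distr \<Omega> (count_space UNIV) (\<lambda>\<omega>. (X \<omega>, M \<omega>)) = measure_pmf Q"
    using ex_pmf_distr[OF Y] by blast
  note suff_iff = sufficient_statistic_iff_factors_through[OF Y Q]
  define P where "P = map_pmf fst Q"
  define c where "c = ennreal (1 / ln b)"
  have c: "c \<noteq> 0" "c \<noteq> \<infinity>" "c < top"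
    using \<open>1 < b\<close> by (auto simp: c_def ennreal_eq_0_iff not_le)
  note dmi = discrete_mutual_information_pmf[OF assms(1,2) Y Q, folded c_def]
  have info_M: "discrete_mutual_information b \<Omega> (\<lambda>\<omega>. S (X \<omega>)) M =
      enn2ereal (c * pmf_information (map_pmf (apfst S) Q))" for S :: "'x \<Rightarrow> 's::countable"
  proof -
    have "apfst S = (\<lambda>y :: 'x \<times> 'm. (S (fst y), snd y))" by auto
    then show ?thesis using dmi[of "\<lambda>y. S (fst y)" snd] by simp
  qed
  have info_X: "discrete_mutual_information b \<Omega> (\<lambda>\<omega>. S (X \<omega>)) X =
      enn2ereal (c * pmf_information (map_pmf (\<lambda>x. (S x, x)) P))" for S :: "'x \<Rightarrow> 's::countable"
    using dmi[of "\<lambda>y. S (fst y)" fst] by (simp add: P_def pmf.map_comp comp_def)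
  have info_XM: "discrete_mutual_information b \<Omega> X M = enn2ereal (c * pmf_information Q)"
    using dmi[of fst snd] by simp
  have cancel: "enn2ereal (c * i) = enn2ereal (c * j) \<longleftrightarrow> i = j" for i j
    using c by (simp add: enn2ereal_inject ennreal_mult_cancel_left)
  have fin: "i < \<infinity>" if "enn2ereal (c * i) < \<infinity>" for i
    using that c by (auto simp: ennreal_mult_top less_top[symmetric])

  have T_suff: "factors_through Q T"
    using sufficiency fin finite_info(1) unfolding info_M info_XM cancel
    by (intro pmf_information_map_eq_iff(2)) auto

  define post where "post = (\<lambda>x m. pmf Q (x, m) / pmf P x)"
  \<comment> \<open>The choice depends on \<open>x\<close> only through \<open>post x\<close>, so it
    labels posteriors; \<open>to_nat\<close> gives the label type over which
    \<open>minimality\<close> quantifies.\<close>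
  define S0 where "S0 = (\<lambda>x. to_nat (SOME x'. post x' = post x))"
  have S0_iff: "S0 x = S0 x' \<longleftrightarrow> post x = post x'" for x x'
  proof
    have rep: "post (SOME x'. post x' = post x) = post x" for x by (rule someI) (rule refl)
    assume "S0 x = S0 x'"
    then have "(SOME y. post y = post x) = (SOME y. post y = post x')"
      unfolding S0_def by (rule injD[OF inj_to_nat])
    then have "post (SOME y. post y = post x) = post (SOME y. post y = post x')"
      by (rule arg_cong)
    then show "post x = post x'" unfolding rep .
  qed (simp add: S0_def)
  have fac_iff: "factors_through Q S \<longleftrightarrow>
      (\<forall>x\<in>set_pmf P. \<forall>x'\<in>set_pmf P. S x = S x' \<longrightarrow> post x = post x')" for S :: "'x \<Rightarrow> 's"
    unfolding factors_through_iff post_def fun_eq_iff P_def[symmetric] Ball_def set_pmf_iff by blast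
  have S0_suff: "factors_through Q S0"
    unfolding fac_iff S0_iff by blast
  have S0_min: "S0 x = S0 x'"
    if "factors_through Q S" "x \<in> set_pmf P" "x' \<in> set_pmf P" "S x = S x'" for S :: "'x \<Rightarrow> 's" and x x'
    using that unfolding fac_iff S0_iff by blast

  define J where "J = map_pmf (\<lambda>x. (T x, x)) P"
  obtain g where g: "\<And>x. x \<in> set_pmf P \<Longrightarrow> S0 x = g (T x)"
    using function_factors_left_gen[of "\<lambda>x. x \<in> set_pmf P" T S0] S0_min[OF T_suff] by blast
  have "map_pmf (apfst g) J = map_pmf (\<lambda>x. (S0 x, x)) P"
    unfolding J_def pmf.map_comp by (intro map_pmf_cong) (auto simp: g)
  \<comment> \<open>\<open>S0\<close> competes in \<open>minimality\<close> because its sufficiency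
    preserves the information about \<open>M\<close>. Data processing along \<open>g\<close>
    supplies the reverse inequality.\<close>
  moreover have "pmf_information J \<le> pmf_information (map_pmf (\<lambda>x. (S0 x, x)) P)"
    using minimality[of S0] pmf_information_map_eq_iff(1)[OF S0_suff] c
    unfolding info_M info_XM info_X cancel J_def[symmetric]
    by (simp add: less_eq_ennreal.rep_eq[symmetric] ennreal_mult_le_mult_iff)
  ultimately have "pmf_information (map_pmf (apfst g) J) = pmf_information J"
    using pmf_information_map_le[of g J] by (intro order.antisym) simp_all
  moreover have "pmf_information J < \<infinity>"
    using fin finite_info(2) unfolding info_X J_def by blast
  ultimately have J: "factors_through J g" by (rule pmf_information_map_eq_iff(2))
  \<comment> \<open>As \<open>g (T x) = g (T x')\<close>, the conditional laws of \<open>X\<close>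
    given these two labels agree, so \<open>(T x', x)\<close> has positive mass under
    \<open>J\<close>. But \<open>J\<close> lives on the graph of \<open>T\<close>, which forces
    \<open>T x' = T x\<close>.\<close>
  have T_min: "T x = T x'" if x: "x \<in> set_pmf P" "x' \<in> set_pmf P" and eq: "S0 x = S0 x'" for x x'
  proof -
    have pos: "pmf (map_pmf fst J) (T y) \<noteq> 0" if "y \<in> set_pmf P" for y
      using that by (force simp: J_def pmf_eq_0_set_pmf)
    have "(T x, x) \<in> set_pmf J" using x by (simp add: J_def)
    then have "pmf J (T x, x) / pmf (map_pmf fst J) (T x) \<noteq> 0"
      using pos x by (simp add: set_pmf_iff)
    moreover have "pmf J (T x, x) / pmf (map_pmf fst J) (T x) = pmf J (T x', x) / pmf (map_pmf fst J) (T x')"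
      using J pos x eq g unfolding factors_through_iff by auto
    ultimately have "(T x', x) \<in> set_pmf J" by (auto simp: set_pmf_iff)
    then show ?thesis by (auto simp: J_def)
  qed
  have AE_P: "AE \<omega> in \<Omega>. A (X \<omega>)" if "\<And>x. x \<in> set_pmf P \<Longrightarrow> A x" for A
  proof -
    have "AE y in distr \<Omega> (count_space UNIV) (\<lambda>\<omega>. (X \<omega>, M \<omega>)). A (fst y)"
      unfolding Q using that by (auto simp: AE_measure_pmf_iff P_def)
    then show ?thesis by (subst (asm) AE_distr_iff) auto
  qed
  have min: "minimal_sufficient_statistic \<Omega> M X T"
    unfolding minimal_sufficient_statistic_def suff_iff
  proof (intro conjI T_suff allI impI)
    fix S :: "'x \<Rightarrow> nat" assume "factors_through Q S"
    \<comment> \<open>On the support, equal values of \<open>S\<close> give equal posteriors, and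
      these give equal values of \<open>T\<close>.\<close>
    from S0_min[OF this] T_min
    have "\<forall>x x'. x \<in> set_pmf P \<and> x' \<in> set_pmf P \<and> S x = S x' \<longrightarrow> T x = T x'"
      by blast
    then obtain f where "\<And>x. x \<in> set_pmf P \<Longrightarrow> T x = f (S x)"
      unfolding function_factors_left_gen by blast
    then show "\<exists>f. AE \<omega> in \<Omega>. T (X \<omega>) = f (S (X \<omega>))"
      by (intro exI[of _ f] AE_P)
  qed
  show ?thesis
  proof (intro conjI min allI impI)
    fix T' :: "'x \<Rightarrow> 'w" assume min': "minimal_sufficient_statistic \<Omega> M X T'"
    \<comment> \<open>Each statistic is minimal and the other sufficient, so each factors through
      the other; \<open>minimal_sufficient_statisticD\<close> covers label types beyond
      \<open>nat\<close>.\<close>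
    obtain f where f: "AE \<omega> in \<Omega>. T' (X \<omega>) = f (T (X \<omega>))"
      using minimal_sufficient_statisticD[OF min'] min unfolding minimal_sufficient_statistic_def by blast
    obtain g where g: "AE \<omega> in \<Omega>. T (X \<omega>) = g (T' (X \<omega>))"
      using minimal_sufficient_statisticD[OF min] min' unfolding minimal_sufficient_statistic_def by blast
    show "invertible_relabelling \<Omega> X T T'"
      unfolding invertible_relabelling_def using AE_conjI[OF f g] by blast
  qed
qed

end
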